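(* Let $Q$ be a family of seminorms on a real, separated and complete locally convex space $E$ which determines the topology $\tau_Q$ of $E$, and let $C$ be a nonempty closed, convex and bounded subset of $E$ such that every sequence in $C$ has a convergent subsequence. Let $T: C\to C$ be a $Q$-nonexpansive mapping such that $\mathrm{Fix}(T)\neq\emptyset$. Assume that the $q$-duality mapping $J_q$ is single valued for each $q\in Q$, and that $(C-C)\cap\{x\in E: q(x)=0\}=\{0\}$ for each $q\in Q$. Let $f: C\to C$ be a $Q$-contraction, and let $(\epsilon_n)_{n\in\mathbb{N}}$ be a sequence in $(0,1)$ with $\lim_{n}\epsilon_n=0$. Then there exist a unique $x\in C$ and a sunny $Q$-nonexpansive retraction $P$ of $C$ onto $\mathrm{Fix}(T)$ such that the sequence $(z_n)_{n\in\mathbb{N}}$ in $C$ generated by $$z_n=\epsilon_n f z_n+(1-\epsilon_n)Tz_n\qquad(n\in\mathbb{N})$$ converges to $Px$ in $\tau_Q$.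
   Context: $E^*$ is the topological dual of $E$, and $\langle x,j\rangle=j(x)$. The space is separated if $\bigcap_{q\in Q}\{x: q(x)=0\}=\{0\}$. For $q\in Q$ and a linear functional $j$ on $E$, $q^*(j)=\sup\{|j(x)|: x\in E,\ q(x)\le 1\}$. The $q$-duality mapping $J_q:E\to 2^{E^*}$ is $J_qx=\{j\in E^*: \langle x,j\rangle=q(x)^2=q^*(j)^2\}$. $T:C\to C$ is $Q$-nonexpansive if $q(Tx-Ty)\le q(x-y)$ for all $x,y\in C$ and all $q\in Q$. $f$ is a $Q$-contraction on $C$ if there is $\beta$ with $0\le\beta<1$ such that $q(f(x)-f(y))\le\beta q(x-y)$ for all $x,y\in C$ and all $q\in Q$. $\mathrm{Fix}(T)$ is the set of fixed points of $T$. $C-C=\{a-b: a,b\in C\}$. For $D\subseteq C$, a retraction of $C$ onto $D$ is a map $P:C\to D$ with $Px=x$ for each $x\in D$. It is sunny if $P(Px+t(x-Px))=Px$ for each $x\in C$ and $t\ge 0$ with $Px+t(x-Px)\in C$. It is sunny $Q$-nonexpansive if it is sunny and $q(Px-Py)\le q(x-y)$ for all $x,y\in C$, $q\in Q$.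
   Formalization: Uniqueness of x in C is false as stated (E=R, C=[0,1], T=f=0: every x works); the formal theorem adds the condition f(Px)=x, and x is the unique point of C satisfying it with z_n converging to Px. *)

theory Defs
  imports "HOL-Analysis.Analysis"
begin

definition seminorm :: "('a::real_vector \<Rightarrow> real) \<Rightarrow> bool" where
  "seminorm q \<longleftrightarrow>
     (\<forall>x y. q (x + y) \<le> q x + q y) \<and> (\<forall>a x. q (a *\<^sub>R x) = \<bar>a\<bar> * q x)"

(* The topology of the type is tau_Q: finite intersections of open q-balls, q in Q, centred at x
   form a neighbourhood base at x. In a type of class uniform_topological_group_add the uniformity
   is then the translation-invariant one induced by tau_Q, so that the library's complete
   (every Cauchy filter converges) is completeness of the locally convex space. *)
definition determines_topology :: "('a::{real_vector, topological_space} \<Rightarrow> real) set \<Rightarrow> bool" where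
  "determines_topology Q \<longleftrightarrow>
     (\<forall>U. open U \<longleftrightarrow>
        (\<forall>x\<in>U. \<exists>F e. finite F \<and> F \<subseteq> Q \<and> e > 0 \<and> {y. \<forall>q\<in>F. q (y - x) < e} \<subseteq> U))"

definition separated :: "('a::real_vector \<Rightarrow> real) set \<Rightarrow> bool" where
  "separated Q \<longleftrightarrow> (\<Inter>q\<in>Q. {x. q x = 0}) = {0}"

(* Boundedness in a topological vector space; the library's bounded is the metric notion. *)
definition tvs_bounded :: "'a::{real_vector, topological_space} set \<Rightarrow> bool" where
  "tvs_bounded C \<longleftrightarrow>
     (\<forall>U. open U \<and> 0 \<in> U \<longrightarrow> (\<exists>s>0. \<forall>t>s. C \<subseteq> (\<lambda>x. t *\<^sub>R x) ` U))"

definition topological_dual :: "('a::{real_vector, topological_space} \<Rightarrow> real) set" where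
  "topological_dual = {j. linear j \<and> continuous_on UNIV j}"

(* Extended-real valued, since the supremum is infinite unless j is continuous for q. *)
definition dual_seminorm :: "('a::real_vector \<Rightarrow> real) \<Rightarrow> ('a \<Rightarrow> real) \<Rightarrow> ereal" where
  "dual_seminorm q j = (SUP x\<in>{x. q x \<le> 1}. ereal \<bar>j x\<bar>)"

definition duality_map ::
    "('a::{real_vector, topological_space} \<Rightarrow> real) \<Rightarrow> 'a \<Rightarrow> ('a \<Rightarrow> real) set" where
  "duality_map q x =
     {j \<in> topological_dual. j x = (q x)\<^sup>2 \<and> ereal ((q x)\<^sup>2) = (dual_seminorm q j)\<^sup>2}"

definition Q_nonexpansive_on ::
    "('a::real_vector \<Rightarrow> real) set \<Rightarrow> 'a set \<Rightarrow> ('a \<Rightarrow> 'a) \<Rightarrow> bool" where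
  "Q_nonexpansive_on Q C T \<longleftrightarrow> (\<forall>q\<in>Q. \<forall>x\<in>C. \<forall>y\<in>C. q (T x - T y) \<le> q (x - y))"

definition Q_contraction_on ::
    "('a::real_vector \<Rightarrow> real) set \<Rightarrow> 'a set \<Rightarrow> ('a \<Rightarrow> 'a) \<Rightarrow> bool" where
  "Q_contraction_on Q C f \<longleftrightarrow>
     (\<exists>\<beta>. 0 \<le> \<beta> \<and> \<beta> < 1 \<and> (\<forall>q\<in>Q. \<forall>x\<in>C. \<forall>y\<in>C. q (f x - f y) \<le> \<beta> * q (x - y)))"

definition Fix :: "'a set \<Rightarrow> ('a \<Rightarrow> 'a) \<Rightarrow> 'a set" where
  "Fix C T = {x \<in> C. T x = x}"

(* Unlike the library's retraction, no continuity is required. *)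
definition retraction_onto :: "'a set \<Rightarrow> 'a set \<Rightarrow> ('a \<Rightarrow> 'a) \<Rightarrow> bool" where
  "retraction_onto C D P \<longleftrightarrow> D \<subseteq> C \<and> P \<in> C \<rightarrow> D \<and> (\<forall>x\<in>D. P x = x)"

definition sunny :: "'a::real_vector set \<Rightarrow> ('a \<Rightarrow> 'a) \<Rightarrow> bool" where
  "sunny C P \<longleftrightarrow>
     (\<forall>x\<in>C. \<forall>t\<ge>0. P x + t *\<^sub>R (x - P x) \<in> C \<longrightarrow> P (P x + t *\<^sub>R (x - P x)) = P x)"

definition sunny_Q_nonexpansive_retraction ::
    "('a::real_vector \<Rightarrow> real) set \<Rightarrow> 'a set \<Rightarrow> 'a set \<Rightarrow> ('a \<Rightarrow> 'a) \<Rightarrow> bool" where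
  "sunny_Q_nonexpansive_retraction Q C D P \<longleftrightarrow>
     retraction_onto C D P \<and> sunny C P \<and> Q_nonexpansive_on Q C P"

definition generated_sequence ::
    "'a::real_vector set \<Rightarrow> ('a \<Rightarrow> 'a) \<Rightarrow> ('a \<Rightarrow> 'a) \<Rightarrow> (nat \<Rightarrow> real) \<Rightarrow> (nat \<Rightarrow> 'a) \<Rightarrow> bool" where
  "generated_sequence C T f \<epsilon> z \<longleftrightarrow>
     (\<forall>n. z n \<in> C \<and> z n = \<epsilon> n *\<^sub>R f (z n) + (1 - \<epsilon> n) *\<^sub>R T (z n))"

end

theory Submission
  imports Defs
begin

text \<open>
  The limit of the implicit iteration is characterised by a variational inequality. Write
  \<open>J\<close> for the duality mapping of a seminorm \<open>q\<close> and \<open>D\<close> for the set of fixed points of \<open>T\<close>. The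
  equation for \<open>z n\<close> says that \<open>\<epsilon> n (z n - f (z n)) = (1 - \<epsilon> n) (T (z n) - z n)\<close>, and testing
  it with \<open>J (z n - p)\<close>, where \<open>p\<close> is a fixed point, makes the right-hand side nonpositive because
  \<open>T\<close> is nonexpansive. Hence \<open>J (z n - p) (z n - f (z n)) \<le> 0\<close>. A single-valued duality mapping is
  continuous from \<open>q\<close> to pointwise convergence (\<open>duality_map_tendsto\<close>), so every cluster
  point \<open>l\<close> of the iteration, which is a fixed point because \<open>\<epsilon> n \<longlonglongrightarrow> 0\<close>, satisfies
  \<open>J (l - p) (l - f l) \<le> 0\<close> for all \<open>p\<close> in \<open>D\<close> and all \<open>q\<close>
  (\<open>cluster_point_variational_solution\<close>).

  For a contraction \<open>f\<close> this inequality has at most one solution: adding the inequalities for two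
  solutions bounds \<open>q (l - l')\<^sup>2\<close> by \<open>\<beta> q (l - l')\<^sup>2\<close>. Sequential compactness then upgrades
  subsequential convergence to convergence (\<open>generated_sequence_tendsto\<close>). In particular, the
  iteration with a constant map \<open>u\<close> in place of \<open>f\<close> converges, and its limit \<open>P u\<close> solves
  \<open>J (P u - p) (P u - u) \<le> 0\<close>, which is the property that makes \<open>P\<close> a sunny nonexpansive
  retraction onto \<open>D\<close> (\<open>sunny_retraction_if_variational_solution\<close>). If \<open>l\<close> is the limit for \<open>f\<close>,
  then \<open>l\<close> also solves the inequality with constant \<open>f l\<close>, so \<open>l = P (f l)\<close> and \<open>x = f l\<close> is the
  required point. It is unique, whatever the retraction, since \<open>x = f (P x)\<close> and \<open>P x\<close> is the limit
  of the iteration.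
\<close>

section \<open>Seminorms and the topology they determine\<close>

lemma
  assumes "seminorm q"
  shows seminorm_triangle: "q (x + y) \<le> q x + q y"
    and seminorm_scaleR: "q (a *\<^sub>R x) = \<bar>a\<bar> * q x"
    and seminorm_zero: "q 0 = 0"
    and seminorm_minus: "q (- x) = q x"
    and seminorm_minus_commute: "q (x - y) = q (y - x)"
    and seminorm_nonneg: "0 \<le> q x"
proof -
  have tri: "q (x + y) \<le> q x + q y" and sc: "q (a *\<^sub>R x) = \<bar>a\<bar> * q x" for x y a
    using assms by (auto simp: seminorm_def)
  show "q (x + y) \<le> q x + q y" "q (a *\<^sub>R x) = \<bar>a\<bar> * q x" by (fact tri sc)+
  show z: "q 0 = 0" using sc[of 0 0] by simp
  have m: "q (- x) = q x" for x using sc[of "-1" x] by simp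
  show "q (- x) = q x" by (fact m)
  show "q (x - y) = q (y - x)" using m[of "x - y"] by simp
  show "0 \<le> q x" using tri[of x "- x"] z m[of x] by simp
qed

lemma seminorm_triangle_diff:
  assumes "seminorm q"
  shows "q (x - z) \<le> q (x - y) + q (y - z)"
  using seminorm_triangle[OF assms, of "x - y" "y - z"] by simp

lemma seminorm_abs_diff_le:
  assumes "seminorm q"
  shows "\<bar>q x - q y\<bar> \<le> q (x - y)"
  using seminorm_triangle[OF assms, of "x - y" y] seminorm_triangle[OF assms, of "y - x" x]
    seminorm_minus_commute[OF assms, of x y] by simp

lemma seminorm_diff_le:
  assumes "seminorm q"
  shows "q (x - y) \<le> q x + q y"
  using seminorm_triangle[OF assms, of x "- y"] seminorm_minus[OF assms, of y] by simp

lemma open_seminorm_ball: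
  assumes "determines_topology Q" "q \<in> Q" "seminorm q"
  shows "open {y. q (y - x) < e}"
proof -
  have "\<exists>F e'. finite F \<and> F \<subseteq> Q \<and> e' > 0 \<and>
      {y'. \<forall>q\<in>F. q (y' - y) < e'} \<subseteq> {y. q (y - x) < e}" if "q (y - x) < e" for y
  proof (intro exI[of _ "{q}"] exI[of _ "e - q (y - x)"] conjI)
    show "finite {q}" "{q} \<subseteq> Q" "0 < e - q (y - x)" using assms that by auto
    show "{y'. \<forall>q'\<in>{q}. q' (y' - y) < e - q (y - x)} \<subseteq> {y. q (y - x) < e}"
      using seminorm_triangle_diff[OF assms(3), of _ x y] by (force intro: le_less_trans)
  qed
  then show ?thesis
    by (intro assms(1)[unfolded determines_topology_def, THEN spec, THEN iffD2] ballI) simp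
qed

lemma tendsto_iff_seminorms:
  assumes "determines_topology Q" "\<forall>q\<in>Q. seminorm q"
  shows "(u \<longlongrightarrow> l) F \<longleftrightarrow> (\<forall>q\<in>Q. ((\<lambda>i. q (u i - l)) \<longlongrightarrow> 0) F)"
proof
  assume L: "(u \<longlongrightarrow> l) F"
  show "\<forall>q\<in>Q. ((\<lambda>i. q (u i - l)) \<longlongrightarrow> 0) F"
  proof (intro ballI tendstoI)
    fix q and e :: real assume q: "q \<in> Q" and e: "0 < e"
    then have sq: "seminorm q" using assms by auto
    have "l \<in> {y. q (y - l) < e}" using e by (simp add: seminorm_zero[OF sq])
    then have "\<forall>\<^sub>F i in F. u i \<in> {y. q (y - l) < e}"
      by (intro topological_tendstoD[OF L] open_seminorm_ball[OF assms(1) q sq])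
    then show "\<forall>\<^sub>F i in F. dist (q (u i - l)) 0 < e"
      by (simp add: seminorm_nonneg[OF sq])
  qed
next
  assume R: "\<forall>q\<in>Q. ((\<lambda>i. q (u i - l)) \<longlongrightarrow> 0) F"
  show "(u \<longlongrightarrow> l) F"
  proof (rule topological_tendstoI)
    fix S assume "open S" "l \<in> S"
    then obtain G e where G: "finite G" "G \<subseteq> Q" "0 < e" "{y. \<forall>q\<in>G. q (y - l) < e} \<subseteq> S"
      using assms(1) unfolding determines_topology_def by meson
    have "\<forall>\<^sub>F i in F. \<forall>q\<in>G. q (u i - l) < e"
      using G R by (intro eventually_ball_finite ballI order_tendstoD(2)[of _ 0]) auto
    then show "\<forall>\<^sub>F i in F. u i \<in> S"
      by eventually_elim (use G in auto)
  qed
qed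

lemma tvs_bounded_imp_seminorm_bounded:
  assumes "determines_topology Q" "q \<in> Q" "seminorm q" "tvs_bounded C"
  shows "\<exists>M. \<forall>x\<in>C. q x \<le> M"
proof -
  have "open {x. q x < 1}" using open_seminorm_ball[OF assms(1-3), of 0 1] by simp
  moreover have "0 \<in> {x. q x < 1}" by (simp add: seminorm_zero[OF assms(3)])
  ultimately obtain s where s: "s > 0" "\<forall>t>s. C \<subseteq> (\<lambda>x. t *\<^sub>R x) ` {x. q x < 1}"
    using assms(4) unfolding tvs_bounded_def by blast
  have "q x \<le> s + 1" if x: "x \<in> C" for x
  proof -
    obtain y where y: "x = (s + 1) *\<^sub>R y" "q y < 1"
      using s(2)[rule_format, of "s + 1"] x by auto
    then have "q x = (s + 1) * q y" using s by (simp add: seminorm_scaleR[OF assms(3)])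
    also have "\<dots> \<le> (s + 1) * 1" using y s by (intro mult_left_mono) auto
    finally show ?thesis by simp
  qed
  then show ?thesis by blast
qed

section \<open>The duality mapping of a seminorm\<close>

lemma dual_seminorm_le_iff:
  assumes q: "seminorm q" and j: "linear j" and M: "0 \<le> M"
  shows "dual_seminorm q j \<le> ereal M \<longleftrightarrow> (\<forall>w. \<bar>j w\<bar> \<le> M * q w)"
proof
  assume "dual_seminorm q j \<le> ereal M"
  then have B: "\<bar>j x\<bar> \<le> M" if "q x \<le> 1" for x
    using that by (auto simp: dual_seminorm_def SUP_le_iff)
  show "\<forall>w. \<bar>j w\<bar> \<le> M * q w"
  proof (rule allI, rule field_le_epsilon)
    fix w and e :: real assume e: "0 < e"
    (* q w may vanish, so w is scaled by a number slightly larger than q w. *)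
    define s where "s = q w + e / (M + 1)"
    have s: "0 < s" "q w \<le> s"
      using e M seminorm_nonneg[OF q, of w] by (auto simp: s_def intro!: add_nonneg_pos)
    have "q ((1 / s) *\<^sub>R w) \<le> 1" using s by (simp add: seminorm_scaleR[OF q] divide_simps)
    from B[OF this] have "\<bar>j w\<bar> \<le> M * s"
      using s by (simp add: linear_scale[OF j] abs_mult divide_simps mult.commute)
    also have "\<dots> = M * q w + M * e / (M + 1)" by (simp add: s_def algebra_simps)
    also have "M * e / (M + 1) \<le> e" using e M by (simp add: divide_simps algebra_simps)
    finally show "\<bar>j w\<bar> \<le> M * q w + e" by simp
  qed
next
  assume B: "\<forall>w. \<bar>j w\<bar> \<le> M * q w"
  have "\<bar>j x\<bar> \<le> M" if "q x \<le> 1" for x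
    using B[rule_format, of x] mult_left_mono[OF that M] by simp
  then show "dual_seminorm q j \<le> ereal M"
    by (auto simp: dual_seminorm_def SUP_le_iff)
qed

text \<open>
  Continuity of \<open>j\<close> and the value of its dual seminorm both come down to one pointwise bound, which,
  unlike the supremum, is preserved under pointwise limits.
\<close>
lemma duality_map_iff:
  assumes top: "determines_topology Q" and qQ: "q \<in> Q" and q: "seminorm q"
  shows "j \<in> duality_map q x \<longleftrightarrow> linear j \<and> j x = (q x)\<^sup>2 \<and> (\<forall>w. \<bar>j w\<bar> \<le> q x * q w)"
proof
  assume "j \<in> duality_map q x"
  then have j: "linear j" "j x = (q x)\<^sup>2" and d: "ereal ((q x)\<^sup>2) = (dual_seminorm q j)\<^sup>2"
    by (auto simp: duality_map_def topological_dual_def)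
  have "ereal \<bar>j 0\<bar> \<le> dual_seminorm q j"
    unfolding dual_seminorm_def by (intro SUP_upper) (simp add: seminorm_zero[OF q])
  then have d0: "0 \<le> dual_seminorm q j" by (simp add: linear_0[OF j(1)] zero_ereal_def)
  have "dual_seminorm q j \<le> ereal (q x)"
  proof (cases "dual_seminorm q j")
    case (real r)
    then have "(q x)\<^sup>2 = r\<^sup>2" "0 \<le> r" using d d0 by auto
    then show ?thesis using real seminorm_nonneg[OF q, of x] by (simp add: power2_eq_iff_nonneg)
  qed (use d d0 in \<open>auto simp: power2_eq_square\<close>)
  then show "linear j \<and> j x = (q x)\<^sup>2 \<and> (\<forall>w. \<bar>j w\<bar> \<le> q x * q w)"
    using j dual_seminorm_le_iff[OF q j(1) seminorm_nonneg[OF q, of x]] by blast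
next
  assume R: "linear j \<and> j x = (q x)\<^sup>2 \<and> (\<forall>w. \<bar>j w\<bar> \<le> q x * q w)"
  then have lin: "linear j" and jx: "j x = (q x)\<^sup>2" and B: "\<bar>j w\<bar> \<le> q x * q w" for w by auto
  have "(j \<longlongrightarrow> j y) (at y)" for y
  proof -
    have "\<forall>\<^sub>F z in at y. dist (j z) (j y) < e" if e: "0 < e" for e
    proof -
      define d where "d = e / (q x + 1)"
      have qx: "0 < q x + 1" using seminorm_nonneg[OF q, of x] by simp
      have d: "0 < d" "(q x + 1) * d = e" using e qx by (auto simp: d_def)
      have "open {z. q (z - y) < d}" "y \<in> {z. q (z - y) < d}"
        using open_seminorm_ball[OF top qQ q] d by (auto simp: seminorm_zero[OF q])
      then have "\<forall>\<^sub>F z in at y. q (z - y) < d"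
        unfolding eventually_at_topological by blast
      then show ?thesis
      proof eventually_elim
        case (elim z)
        have "dist (j z) (j y) = \<bar>j (z - y)\<bar>" by (simp add: dist_real_def linear_diff[OF lin])
        also have "\<dots> \<le> q x * q (z - y)" by (fact B)
        also have "\<dots> \<le> (q x + 1) * q (z - y)"
          using seminorm_nonneg[OF q] by (intro mult_right_mono) auto
        also have "\<dots> < (q x + 1) * d" using elim qx by simp
        finally show ?case using d by simp
      qed
    qed
    then show ?thesis by (rule tendstoI)
  qed
  then have "j \<in> topological_dual"
    using lin by (simp add: topological_dual_def continuous_on_def)
  moreover have "dual_seminorm q j = ereal (q x)"
  proof (rule antisym)
    show "dual_seminorm q j \<le> ereal (q x)"
      using B dual_seminorm_le_iff[OF q lin seminorm_nonneg[OF q, of x]] by blast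
    (* The supremum is attained at the normalised vector. If q x = 0, then 1 / q x = 0 and the
       vector 0 attains it. *)
    have "ereal \<bar>j ((1 / q x) *\<^sub>R x)\<bar> \<le> dual_seminorm q j"
      unfolding dual_seminorm_def using seminorm_nonneg[OF q, of x]
      by (intro SUP_upper) (simp add: seminorm_scaleR[OF q])
    then show "ereal (q x) \<le> dual_seminorm q j"
      using seminorm_nonneg[OF q, of x]
      by (simp add: linear_scale[OF lin] jx power2_eq_square)
  qed
  ultimately show "j \<in> duality_map q x" using jx by (simp add: duality_map_def)
qed

text \<open>
  This is the Banach-Alaoglu argument. By Tychonoff's theorem the functionals \<open>J i\<close> cluster
  pointwise, any cluster functional again belongs to the duality mapping at the limit point, and
  there is only one functional there.
\<close>
lemma duality_map_tendsto:
  assumes top: "determines_topology Q" and qQ: "q \<in> Q" and q: "seminorm q"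
    and single: "duality_map q x = {j}"
    and J: "\<And>i. J i \<in> duality_map q (X i)"
    and X: "((\<lambda>i. q (X i - x)) \<longlongrightarrow> 0) F"
  shows "((\<lambda>i. J i w) \<longlongrightarrow> j w) F"
proof (rule ccontr)
  note dual_iff = duality_map_iff[OF top qQ q]
  note nonneg = seminorm_nonneg[OF q]
  have J_linear: "linear (J i)" and J_diag: "J i (X i) = (q (X i))\<^sup>2"
    and J_bound: "\<bar>J i v\<bar> \<le> q (X i) * q v" for i v
    using J[of i] by (auto simp: dual_iff)
  assume "\<not> ((\<lambda>i. J i w) \<longlongrightarrow> j w) F"
  then obtain e where e: "0 < e" "\<not> (\<forall>\<^sub>F i in F. dist (J i w) (j w) < e)"
    unfolding tendsto_iff by blast
  define B where "B = {i. e \<le> dist (J i w) (j w)}"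
  define F' where "F' = inf F (principal B)"
  have F': "F' \<noteq> bot"
    using e(2) by (simp add: F'_def trivial_limit_def eventually_inf_principal B_def not_le)
  have F'_le: "F' \<le> F" by (simp add: F'_def)
  have qX: "((\<lambda>i. q (X i)) \<longlongrightarrow> q x) F"
  proof (rule Lim_null[THEN iffD2], rule Lim_null_comparison[OF _ X])
    show "\<forall>\<^sub>F i in F. norm (q (X i) - q x) \<le> q (X i - x)"
      using seminorm_abs_diff_le[OF q] by simp
  qed
  define K where "K = (\<Pi>\<^sub>E v\<in>UNIV. {- ((q x + 1) * q v) .. (q x + 1) * q v})"
  have "compactin (product_topology (\<lambda>v. euclidean) UNIV) K"
    unfolding K_def compactin_PiE by simp
  then have "compact K"
    by (simp add: euclidean_product_topology)
  moreover have "\<forall>\<^sub>F i in F. J i \<in> K"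
    using order_tendstoD(2)[OF qX, of "q x + 1", simplified]
  proof eventually_elim
    case (elim i)
    have "\<bar>J i v\<bar> \<le> (q x + 1) * q v" for v
      using J_bound[of i v] mult_right_mono[OF less_imp_le[OF elim] nonneg[of v]] by linarith
    then have "- ((q x + 1) * q v) \<le> J i v" "J i v \<le> (q x + 1) * q v" for v
      by (simp_all add: abs_le_iff minus_le_iff)
    then show ?case by (simp add: K_def PiE_UNIV_domain)
  qed
  then have "\<forall>\<^sub>F k in filtermap J F'. k \<in> K"
    using F'_le by (auto simp: eventually_filtermap le_filter_def)
  ultimately obtain k where k: "inf (nhds k) (filtermap J F') \<noteq> bot"
    using F' unfolding compact_filter by (metis filtermap_bot_iff)
  (* G is the filter of indices along which J converges to the cluster functional k. *)
  define G where "G = inf (filtercomap J (nhds k)) F'"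
  have G: "G \<noteq> bot"
  proof
    assume "G = bot"
    then obtain P R where PR: "eventually P (nhds k)" "eventually R F'" "\<And>i. P (J i) \<Longrightarrow> R i \<Longrightarrow> False"
      unfolding G_def trivial_limit_def eventually_inf eventually_filtercomap by metis
    have "eventually (\<lambda>j. \<not> P j) (filtermap J F')"
      unfolding eventually_filtermap using PR(2) by eventually_elim (use PR(3) in blast)
    then have "inf (nhds k) (filtermap J F') = bot"
      unfolding trivial_limit_def eventually_inf using PR(1) by blast
    with k show False by simp
  qed
  have G_le: "G \<le> F" using F'_le by (simp add: G_def le_infI2)
  have "filterlim J (nhds k) G"
    unfolding filterlim_def G_def
    by (meson filtermap_filtercomap filtermap_mono inf_le1 order_trans)
  then have lim: "((\<lambda>i. J i v) \<longlongrightarrow> k v) G" for v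
    by (rule continuous_on_tendsto_compose[OF continuous_on_product_coordinates]) simp_all
  have qXG: "((\<lambda>i. q (X i)) \<longlongrightarrow> q x) G" and XG: "((\<lambda>i. q (X i - x)) \<longlongrightarrow> 0) G"
    using qX X G_le by (auto intro: tendsto_mono)
  have "linear k"
  proof (rule linearI)
    fix a b :: 'a and c :: real
    show "k (a + b) = k a + k b"
      using tendsto_unique[OF G lim[of "a + b"]] tendsto_add[OF lim[of a] lim[of b]]
      by (simp add: linear_add[OF J_linear])
    show "k (c *\<^sub>R a) = c *\<^sub>R k a"
      using tendsto_unique[OF G lim[of "c *\<^sub>R a"]] tendsto_scaleR[OF tendsto_const lim[of a], of c]
      by (simp add: linear_scale[OF J_linear])
  qed
  moreover have k_bound: "\<bar>k v\<bar> \<le> q x * q v" for v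
    by (rule tendsto_le[OF G tendsto_mult[OF qXG tendsto_const] tendsto_rabs[OF lim]])
      (simp add: J_bound)
  moreover have "k x = (q x)\<^sup>2"
  proof -
    have "((\<lambda>i. q (X i) * q (X i - x)) \<longlongrightarrow> 0) G"
      using tendsto_mult[OF qXG XG] by simp
    then have "((\<lambda>i. J i (X i - x)) \<longlongrightarrow> 0) G"
      by (rule Lim_null_comparison[rotated]) (simp add: J_bound)
    then have "((\<lambda>i. (q (X i))\<^sup>2 - J i (X i - x)) \<longlongrightarrow> (q x)\<^sup>2 - 0) G"
      by (intro tendsto_intros qXG)
    then have "((\<lambda>i. J i x) \<longlongrightarrow> (q x)\<^sup>2) G"
      by (simp add: linear_diff[OF J_linear] J_diag)
    then show ?thesis using lim tendsto_unique[OF G] by blast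
  qed
  ultimately have "k \<in> duality_map q x" by (simp add: dual_iff)
  then have "k = j" using single by simp
  have "G \<le> principal B" by (simp add: G_def F'_def le_infI2)
  then have "\<forall>\<^sub>F i in G. i \<in> B" by (simp add: le_principal)
  then have "\<forall>\<^sub>F i in G. e \<le> dist (J i w) (j w)" by (simp add: B_def)
  moreover have "\<forall>\<^sub>F i in G. dist (J i w) (j w) < e"
    using tendstoD[OF lim[of w] e(1)] \<open>k = j\<close> by simp
  ultimately have "\<forall>\<^sub>F i in G. False" by eventually_elim simp
  then show False using G by simp
qed

section \<open>The variational inequality\<close>

locale smooth_seminorms =
  fixes Q :: "('a::{real_vector, topological_space} \<Rightarrow> real) set"
  assumes seminorms: "\<forall>q\<in>Q. seminorm q"
    and top: "determines_topology Q"
    and sep: "separated Q"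
    and smooth: "\<forall>q\<in>Q. \<forall>x. is_singleton (duality_map q x)"
begin

lemma seminorm: "q \<in> Q \<Longrightarrow> seminorm q"
  using seminorms by blast

lemma eq_if_seminorms_zero:
  assumes "\<And>q. q \<in> Q \<Longrightarrow> q (x - y) \<le> 0"
  shows "x = y"
proof -
  have "q (x - y) = 0" if "q \<in> Q" for q
    using assms[OF that] seminorm_nonneg[OF seminorm[OF that], of "x - y"] by simp
  then have "x - y \<in> (\<Inter>q\<in>Q. {x. q x = 0})" by simp
  then have "x - y \<in> {0}" using sep unfolding separated_def by (simp only:)
  then show ?thesis by simp
qed

lemma seminorm_tendsto_zero:
  assumes "(u \<longlongrightarrow> l) F" "q \<in> Q"
  shows "((\<lambda>i. q (u i - l)) \<longlongrightarrow> 0) F"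
  using assms tendsto_iff_seminorms[OF top seminorms, of u l F] by blast

lemma eq_if_tendsto_same:
  fixes u :: "nat \<Rightarrow> 'a"
  assumes "u \<longlonglongrightarrow> x" "u \<longlonglongrightarrow> y"
  shows "x = y"
proof (rule eq_if_seminorms_zero)
  fix q assume q: "q \<in> Q"
  have "(\<lambda>n. q (u n - x) + q (u n - y)) \<longlonglongrightarrow> 0 + 0"
    by (intro tendsto_add seminorm_tendsto_zero assms q)
  moreover have "q (x - y) \<le> q (u n - x) + q (u n - y)" for n
    using seminorm_triangle_diff[OF seminorm[OF q], of x y "u n"]
      seminorm_minus_commute[OF seminorm[OF q], of x "u n"] by simp
  ultimately show "q (x - y) \<le> 0" by (intro LIMSEQ_le_const) auto
qed

lemma duality_map_iff:
  assumes "q \<in> Q"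
  shows "j \<in> duality_map q x \<longleftrightarrow> linear j \<and> j x = (q x)\<^sup>2 \<and> (\<forall>w. \<bar>j w\<bar> \<le> q x * q w)"
  by (rule duality_map_iff[OF top assms seminorm[OF assms]])

lemma duality_map_ex:
  assumes "q \<in> Q"
  shows "\<exists>j. duality_map q x = {j}"
  using smooth assms unfolding is_singleton_def by blast

lemma duality_map_uminus:
  assumes "q \<in> Q" "j \<in> duality_map q x"
  shows "(\<lambda>w. - j w) \<in> duality_map q (- x)"
  using assms(2) unfolding duality_map_iff[OF assms(1)]
  by (auto simp: seminorm_minus[OF seminorm[OF assms(1)]] linear_neg linear_compose_neg)

definition variational_solution :: "'a set \<Rightarrow> ('a \<Rightarrow> 'a) \<Rightarrow> 'a \<Rightarrow> bool" where
  "variational_solution D g z \<longleftrightarrow>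
     z \<in> D \<and> (\<forall>q\<in>Q. \<forall>p\<in>D. \<forall>j\<in>duality_map q (z - p). j (z - g z) \<le> 0)"

text \<open>
  Testing the inequality of each solution with the other one and adding gives
  \<open>J (z - z') ((z - g z) - (z' - h z')) \<le> 0\<close>, because \<open>J (z' - z) = - J (z - z')\<close>.
\<close>
lemma variational_solutions_seminorm_le:
  assumes z: "variational_solution D g z" and z': "variational_solution D h z'" and q: "q \<in> Q"
  shows "q (z - z') \<le> q (g z - h z')"
proof -
  obtain j where j: "j \<in> duality_map q (z - z')"
    using duality_map_ex[OF q, of "z - z'"] by blast
  have lin: "linear j" and jd: "j (z - z') = (q (z - z'))\<^sup>2"
    and jb: "\<And>w. \<bar>j w\<bar> \<le> q (z - z') * q w"
    using j duality_map_iff[OF q] by auto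
  have "j (z - g z) \<le> 0"
    using z z' q j by (auto simp: variational_solution_def)
  moreover have "- j (z' - h z') \<le> 0"
    using z z' q duality_map_uminus[OF q j] unfolding variational_solution_def minus_diff_eq
    by fastforce
  ultimately have "(q (z - z'))\<^sup>2 \<le> j (g z - h z')"
    using jd by (simp add: linear_diff[OF lin])
  also have "\<dots> \<le> q (z - z') * q (g z - h z')" using jb[of "g z - h z'"] by simp
  finally show ?thesis
    using seminorm_nonneg[OF seminorm[OF q]]
    by (cases "q (z - z') = 0") (auto simp: power2_eq_square less_le)
qed

lemma variational_solution_unique:
  assumes "Q_contraction_on Q C g" "D \<subseteq> C"
    and z: "variational_solution D g z" and z': "variational_solution D g z'"
  shows "z = z'"
proof (rule eq_if_seminorms_zero)
  fix q assume q: "q \<in> Q"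
  obtain \<beta> where \<beta>: "\<beta> < 1" "q (g z - g z') \<le> \<beta> * q (z - z')"
    using assms q unfolding Q_contraction_on_def variational_solution_def by blast
  then have "(1 - \<beta>) * q (z - z') \<le> 0"
    using variational_solutions_seminorm_le[OF z z' q] by (simp add: algebra_simps)
  then show "q (z - z') \<le> 0" using \<beta> by (simp add: mult_le_0_iff)
qed

lemma Q_contraction_on_const: "Q_contraction_on Q C (\<lambda>_. u)"
  unfolding Q_contraction_on_def
  using seminorms by (intro exI[of _ 0]) (auto simp: seminorm_zero)

text \<open>
  Moving the anchor along the ray from \<open>P x\<close> through \<open>x\<close> multiplies \<open>P x - x\<close> by a nonnegative
  factor, so \<open>P x\<close> still solves the inequality for the new anchor; that is sunniness.
\<close>
lemma sunny_retraction_if_variational_solution: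
  assumes "D \<subseteq> C" and P: "\<And>u. u \<in> C \<Longrightarrow> variational_solution D (\<lambda>_. u) (P u)"
  shows "sunny_Q_nonexpansive_retraction Q C D P"
proof -
  note unique = variational_solution_unique[OF Q_contraction_on_const assms(1)]
  have "P u = u" if "u \<in> D" for u
  proof (rule unique[OF P])
    show "variational_solution D (\<lambda>_. u) u"
      using that duality_map_iff by (auto simp: variational_solution_def linear_0)
  qed (use that assms in auto)
  then have "retraction_onto C D P"
    using assms by (auto simp: retraction_onto_def variational_solution_def)
  moreover have "P (P x + t *\<^sub>R (x - P x)) = P x"
    if x: "x \<in> C" and t: "0 \<le> t" and y: "P x + t *\<^sub>R (x - P x) \<in> C" for x t
  proof (rule unique[OF P[OF y]])
    have "j (P x - (P x + t *\<^sub>R (x - P x))) \<le> 0"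
      if "q \<in> Q" "p \<in> D" "j \<in> duality_map q (P x - p)" for q p j
    proof -
      have "linear j" using that duality_map_iff by blast
      have "P x - (P x + t *\<^sub>R (x - P x)) = t *\<^sub>R (P x - x)" by (simp add: algebra_simps)
      moreover have "j (P x - x) \<le> 0"
        using P[OF x] that by (auto simp: variational_solution_def)
      ultimately show ?thesis
        using t linear_scale[OF \<open>linear j\<close>] by (simp add: mult_nonneg_nonpos)
    qed
    then show "variational_solution D (\<lambda>_. P x + t *\<^sub>R (x - P x)) (P x)"
      using P[OF x] by (auto simp: variational_solution_def)
  qed
  then have "sunny C P" by (simp add: sunny_def)
  moreover have "Q_nonexpansive_on Q C P"
    using variational_solutions_seminorm_le[OF P P] by (simp add: Q_nonexpansive_on_def)
  ultimately show ?thesis by (simp add: sunny_Q_nonexpansive_retraction_def)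
qed

section \<open>The implicit iteration\<close>

text \<open>
  Consecutive Picard iterates approach each other in every seminorm, so any cluster point of
  the iteration is a fixed point; sequential compactness provides one.
\<close>
lemma contraction_fixed_point:
  assumes C: "seq_compact C" "C \<noteq> {}" and S: "S \<in> C \<rightarrow> C" "Q_contraction_on Q C S"
  shows "\<exists>!x. x \<in> C \<and> S x = x"
proof -
  obtain k where k: "0 \<le> k" "k < 1"
    and contr: "\<And>q x y. q \<in> Q \<Longrightarrow> x \<in> C \<Longrightarrow> y \<in> C \<Longrightarrow> q (S x - S y) \<le> k * q (x - y)"
    using S(2) unfolding Q_contraction_on_def by blast
  obtain a where "a \<in> C" using C(2) by blast
  define u where "u = (\<lambda>n. (S ^^ n) a)"
  have uC: "u n \<in> C" for n
    unfolding u_def by (induction n) (use \<open>a \<in> C\<close> S in auto)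
  have u_Suc: "u (Suc n) = S (u n)" for n by (simp add: u_def)
  have step: "q (u (Suc n) - u n) \<le> k ^ n * q (u 1 - u 0)" if "q \<in> Q" for q n
  proof (induction n)
    case (Suc n)
    have "q (u (Suc (Suc n)) - u (Suc n)) \<le> k * q (u (Suc n) - u n)"
      using contr[OF that uC uC, of "Suc n" n] by (simp only: u_Suc)
    also have "\<dots> \<le> k * (k ^ n * q (u 1 - u 0))" using Suc k by (intro mult_left_mono)
    finally show ?case by simp
  qed simp
  obtain l r where l: "l \<in> C" and r: "strict_mono r" and lim: "(u \<circ> r) \<longlonglongrightarrow> l"
    using C(1) uC unfolding seq_compact_def by metis
  have "S l = l"
  proof (rule eq_if_seminorms_zero)
    fix q assume q: "q \<in> Q"
    note sq = seminorm[OF q]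
    have d: "(\<lambda>n. q (u (r n) - l)) \<longlonglongrightarrow> 0"
      using seminorm_tendsto_zero[OF lim q] by (simp add: o_def)
    have "(\<lambda>n. k ^ n) \<longlonglongrightarrow> 0" using k by (intro LIMSEQ_realpow_zero)
    from LIMSEQ_subseq_LIMSEQ[OF this r] have kr: "(\<lambda>n. k ^ r n) \<longlonglongrightarrow> 0" by (simp add: o_def)
    have "(\<lambda>n. k * q (u (r n) - l) + k ^ r n * q (u 1 - u 0) + q (u (r n) - l))
        \<longlonglongrightarrow> k * 0 + 0 * q (u 1 - u 0) + 0"
      by (intro tendsto_intros d kr)
    moreover have "q (S l - l)
        \<le> k * q (u (r n) - l) + k ^ r n * q (u 1 - u 0) + q (u (r n) - l)" for n
      using seminorm_triangle_diff[OF sq, of "S l" l "u (Suc (r n))"]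
        seminorm_triangle_diff[OF sq, of "u (Suc (r n))" l "u (r n)"]
        contr[OF q l uC[of "r n"]] step[OF q, of "r n"]
        seminorm_minus_commute[OF sq, of "u (r n)" l]
      unfolding u_Suc by simp
    ultimately show "q (S l - l) \<le> 0" by (intro LIMSEQ_le_const) auto
  qed
  moreover have "x = y" if x: "x \<in> C" "S x = x" and y: "y \<in> C" "S y = y" for x y
  proof (rule eq_if_seminorms_zero)
    fix q assume q: "q \<in> Q"
    have "(1 - k) * q (x - y) \<le> 0" using contr[OF q x(1) y(1)] x y by (simp add: algebra_simps)
    then show "q (x - y) \<le> 0" using k by (simp add: mult_le_0_iff)
  qed
  ultimately show ?thesis using l by blast
qed

end

locale implicit_iteration = smooth_seminorms Q
  for Q :: "('a::{real_vector, topological_space} \<Rightarrow> real) set" +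
  fixes C :: "'a set" and T :: "'a \<Rightarrow> 'a" and \<epsilon> :: "nat \<Rightarrow> real"
  assumes C_ne: "C \<noteq> {}" and C_convex: "convex C" and C_bounded: "tvs_bounded C"
    and C_seq_compact: "seq_compact C"
    and T_self: "T \<in> C \<rightarrow> C" and T_nonexp: "Q_nonexpansive_on Q C T"
    and \<epsilon>: "\<forall>n. 0 < \<epsilon> n \<and> \<epsilon> n < 1" and \<epsilon>_lim: "\<epsilon> \<longlonglongrightarrow> 0"
begin

lemma generated_sequence_ex1:
  assumes g: "g \<in> C \<rightarrow> C" "Q_contraction_on Q C g"
  shows "\<exists>!z. generated_sequence C T g \<epsilon> z"
proof -
  define S where "S = (\<lambda>n z. \<epsilon> n *\<^sub>R g z + (1 - \<epsilon> n) *\<^sub>R T z)"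
  have "\<exists>!x. x \<in> C \<and> S n x = x" for n
  proof (rule contraction_fixed_point[OF C_seq_compact C_ne])
    have e: "0 < \<epsilon> n" "\<epsilon> n < 1" using \<epsilon> by auto
    show "S n \<in> C \<rightarrow> C"
      using g T_self e C_convex unfolding S_def by (auto intro!: convexD)
    obtain \<beta> where \<beta>: "0 \<le> \<beta>" "\<beta> < 1"
      and gc: "\<forall>q\<in>Q. \<forall>x\<in>C. \<forall>y\<in>C. q (g x - g y) \<le> \<beta> * q (x - y)"
      using g(2) unfolding Q_contraction_on_def by blast
    have "q (S n x - S n y) \<le> (\<epsilon> n * \<beta> + (1 - \<epsilon> n)) * q (x - y)"
      if q: "q \<in> Q" and xy: "x \<in> C" "y \<in> C" for q x y
    proof -
      note sq = seminorm[OF q]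
      have "S n x - S n y = \<epsilon> n *\<^sub>R (g x - g y) + (1 - \<epsilon> n) *\<^sub>R (T x - T y)"
        by (simp add: S_def algebra_simps)
      then have "q (S n x - S n y) \<le> \<epsilon> n * q (g x - g y) + (1 - \<epsilon> n) * q (T x - T y)"
        using seminorm_triangle[OF sq, of "\<epsilon> n *\<^sub>R (g x - g y)" "(1 - \<epsilon> n) *\<^sub>R (T x - T y)"] e
        by (simp add: seminorm_scaleR[OF sq])
      also have "\<dots> \<le> \<epsilon> n * (\<beta> * q (x - y)) + (1 - \<epsilon> n) * q (x - y)"
        using gc T_nonexp q xy e
        by (intro add_mono mult_left_mono) (auto simp: Q_nonexpansive_on_def)
      finally show ?thesis by (simp add: algebra_simps)
    qed
    moreover have "0 \<le> \<epsilon> n * \<beta> + (1 - \<epsilon> n)" using e \<beta> by simp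
    moreover have "\<epsilon> n * \<beta> + (1 - \<epsilon> n) < 1" using e \<beta> by simp
    ultimately show "Q_contraction_on Q C (S n)" unfolding Q_contraction_on_def by blast
  qed
  note ex1 = this
  have "\<exists>!z. \<forall>n. z n \<in> C \<and> S n (z n) = z n"
  proof (rule ex1I[of _ "\<lambda>n. THE x. x \<in> C \<and> S n x = x"])
    show "\<forall>n. (THE x. x \<in> C \<and> S n x = x) \<in> C
        \<and> S n (THE x. x \<in> C \<and> S n x = x) = (THE x. x \<in> C \<and> S n x = x)"
      using theI'[OF ex1] by blast
  qed (rule ext, use the1_equality[OF ex1] in metis)
  moreover have "generated_sequence C T g \<epsilon> z \<longleftrightarrow> (\<forall>n. z n \<in> C \<and> S n (z n) = z n)" for z
    by (auto simp: generated_sequence_def S_def)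
  ultimately show ?thesis by simp
qed

text \<open>
  The map \<open>g\<close> is kept general because both instances are needed: \<open>g = f\<close> identifies the limit of
  the iteration, and the constant maps produce the values of the retraction. The limit is taken
  in the base point \<open>z n - p\<close> of the duality mapping and in its argument \<open>z n - g (z n)\<close>
  simultaneously.
\<close>
lemma cluster_point_variational_solution:
  assumes g: "g \<in> C \<rightarrow> C" "Q_contraction_on Q C g" and z: "generated_sequence C T g \<epsilon> z"
    and r: "strict_mono r" and l: "l \<in> C" and lim: "(z \<circ> r) \<longlonglongrightarrow> l"
  shows "variational_solution (Fix C T) g l"
proof -
  have zC: "z n \<in> C" and z_eq: "z n = \<epsilon> n *\<^sub>R g (z n) + (1 - \<epsilon> n) *\<^sub>R T (z n)" for n
    using z by (auto simp: generated_sequence_def)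
  have d: "(\<lambda>n. q (z (r n) - l)) \<longlonglongrightarrow> 0" if "q \<in> Q" for q
    using seminorm_tendsto_zero[OF lim that] by (simp add: o_def)
  have \<epsilon>r: "(\<lambda>n. \<epsilon> (r n)) \<longlonglongrightarrow> 0"
    using LIMSEQ_subseq_LIMSEQ[OF \<epsilon>_lim r] by (simp add: o_def)
  have "T l = l"
  proof (rule eq_if_seminorms_zero)
    fix q assume q: "q \<in> Q"
    note sq = seminorm[OF q]
    obtain M where M: "\<And>x. x \<in> C \<Longrightarrow> q x \<le> M"
      using tvs_bounded_imp_seminorm_bounded[OF top q sq C_bounded] by blast
    have residual: "q (T (z n) - z n) \<le> \<epsilon> n * (M + M)" for n
    proof -
      have "T (z n) - z n = T (z n) - (\<epsilon> n *\<^sub>R g (z n) + (1 - \<epsilon> n) *\<^sub>R T (z n))"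
        using z_eq[of n] by simp
      also have "\<dots> = \<epsilon> n *\<^sub>R (T (z n) - g (z n))" by (simp add: algebra_simps)
      finally have "q (T (z n) - z n) = \<epsilon> n * q (T (z n) - g (z n))"
        using \<epsilon> by (simp add: seminorm_scaleR[OF sq] less_imp_le)
      also have "\<dots> \<le> \<epsilon> n * (M + M)"
      proof (intro mult_left_mono)
        have "T (z n) \<in> C" "g (z n) \<in> C" using T_self g zC by auto
        then show "q (T (z n) - g (z n)) \<le> M + M"
          using seminorm_diff_le[OF sq, of "T (z n)" "g (z n)"] M[of "T (z n)"] M[of "g (z n)"]
          by linarith
      qed (use \<epsilon> in \<open>simp add: less_imp_le\<close>)
      finally show ?thesis .
    qed
    have "(\<lambda>n. q (z (r n) - l) + \<epsilon> (r n) * (M + M) + q (z (r n) - l)) \<longlonglongrightarrow> 0 + 0 * (M + M) + 0"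
      by (intro tendsto_intros d[OF q] \<epsilon>r)
    moreover have "q (T l - l) \<le> q (z (r n) - l) + \<epsilon> (r n) * (M + M) + q (z (r n) - l)" for n
    proof -
      have "q (T l - T (z (r n))) \<le> q (z (r n) - l)"
        using T_nonexp q l zC seminorm_minus_commute[OF sq, of "z (r n)" l]
        by (auto simp: Q_nonexpansive_on_def)
      then show ?thesis
        using seminorm_triangle_diff[OF sq, of "T l" l "T (z (r n))"]
          seminorm_triangle_diff[OF sq, of "T (z (r n))" l "z (r n)"] residual[of "r n"] by linarith
    qed
    ultimately show "q (T l - l) \<le> 0" by (intro LIMSEQ_le_const) auto
  qed
  moreover have "j (l - g l) \<le> 0"
    if q: "q \<in> Q" and p: "p \<in> Fix C T" and j: "j \<in> duality_map q (l - p)" for q p j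
  proof -
    note sq = seminorm[OF q]
    have single: "duality_map q (l - p) = {j}"
      using duality_map_ex[OF q, of "l - p"] j by auto
    have "\<exists>j. j \<in> duality_map q (z n - p)" for n
      using duality_map_ex[OF q, of "z n - p"] by auto
    then obtain J where J: "\<And>n. J n \<in> duality_map q (z n - p)" by metis
    have J_linear: "linear (J n)" and J_diag: "J n (z n - p) = (q (z n - p))\<^sup>2"
      and J_bound: "\<bar>J n w\<bar> \<le> q (z n - p) * q w" for n w
      using J[of n] by (auto simp: duality_map_iff[OF q])
    have approx: "J n (z n - g (z n)) \<le> 0" for n
    proof -
      have "J n (T (z n) - p) \<le> q (z n - p) * q (T (z n) - p)"
        using J_bound[of n "T (z n) - p"] by simp
      also have "\<dots> \<le> q (z n - p) * q (z n - p)"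
      proof (intro mult_left_mono seminorm_nonneg[OF sq])
        have "q (T (z n) - T p) \<le> q (z n - p)"
          using T_nonexp q p zC unfolding Q_nonexpansive_on_def Fix_def by blast
        then show "q (T (z n) - p) \<le> q (z n - p)" using p by (simp add: Fix_def)
      qed
      finally have "J n (T (z n) - z n) \<le> 0"
        using J_diag[of n] by (simp add: linear_diff[OF J_linear] power2_eq_square)
      moreover have "\<epsilon> n * J n (z n - g (z n)) = (1 - \<epsilon> n) * J n (T (z n) - z n)"
      proof -
        have "\<epsilon> n *\<^sub>R (z n - g (z n)) - (1 - \<epsilon> n) *\<^sub>R (T (z n) - z n)
            = z n - (\<epsilon> n *\<^sub>R g (z n) + (1 - \<epsilon> n) *\<^sub>R T (z n))"
          by (simp add: algebra_simps)
        then have "\<epsilon> n *\<^sub>R (z n - g (z n)) = (1 - \<epsilon> n) *\<^sub>R (T (z n) - z n)"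
          using z_eq[of n] by simp
        then have "J n (\<epsilon> n *\<^sub>R (z n - g (z n))) = J n ((1 - \<epsilon> n) *\<^sub>R (T (z n) - z n))"
          by simp
        then show ?thesis by (simp add: linear_scale[OF J_linear])
      qed
      ultimately have "\<epsilon> n * J n (z n - g (z n)) \<le> 0"
        using \<epsilon> by (simp add: mult_nonneg_nonpos less_imp_le)
      then show ?thesis using \<epsilon>[rule_format, of n] by (auto simp: mult_le_0_iff)
    qed
    obtain \<beta> where \<beta>: "\<beta> < 1" and gc: "\<And>x y. x \<in> C \<Longrightarrow> y \<in> C \<Longrightarrow> q (g x - g y) \<le> \<beta> * q (x - y)"
      using g(2) q unfolding Q_contraction_on_def by blast
    have gl: "q (g (z n) - g l) \<le> q (z n - l)" for n
      using gc[OF zC l, of n] mult_right_mono[of \<beta> 1 "q (z n - l)"] \<beta> seminorm_nonneg[OF sq, of "z n - l"]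
      by simp
    have "(\<lambda>n. q ((z (r n) - p) - (l - p))) \<longlonglongrightarrow> 0" using d[OF q] by simp
    from duality_map_tendsto[OF top q sq single J this]
    have main: "(\<lambda>n. J (r n) (l - g l)) \<longlonglongrightarrow> j (l - g l)" .
    (* The argument z n - g (z n) varies with n as well; its error is controlled by J_bound. *)
    have err: "J n (l - g l) \<le> (q (z n - l) + q (l - p)) * (2 * q (z n - l))" for n
    proof -
      have "J n (l - g l) = J n (z n - g (z n)) + J n ((l - z n) + (g (z n) - g l))"
        by (simp add: linear_add[OF J_linear, symmetric])
      also have "\<dots> \<le> q (z n - p) * q ((l - z n) + (g (z n) - g l))"
        using approx[of n] J_bound[of n "(l - z n) + (g (z n) - g l)"] by linarith
      also have "\<dots> \<le> (q (z n - l) + q (l - p)) * (2 * q (z n - l))"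
      proof (rule mult_mono)
        show "q (z n - p) \<le> q (z n - l) + q (l - p)" by (rule seminorm_triangle_diff[OF sq])
        show "q ((l - z n) + (g (z n) - g l)) \<le> 2 * q (z n - l)"
          using seminorm_triangle[OF sq, of "l - z n" "g (z n) - g l"] gl[of n]
            seminorm_minus_commute[OF sq, of l "z n"] by simp
      qed (auto intro!: add_nonneg_nonneg seminorm_nonneg[OF sq])
      finally show ?thesis .
    qed
    have "(\<lambda>n. (q (z (r n) - l) + q (l - p)) * (2 * q (z (r n) - l)))
        \<longlonglongrightarrow> (0 + q (l - p)) * (2 * 0)"
      by (intro tendsto_intros d[OF q])
    then have "j (l - g l) \<le> (0 + q (l - p)) * (2 * 0)"
      by (rule LIMSEQ_le[OF main]) (use err in auto)
    then show ?thesis by simp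
  qed
  ultimately show ?thesis using l by (simp add: variational_solution_def Fix_def)
qed

text \<open>
  All cluster points solve the same inequality and hence coincide, so a subsequence staying away
  from the common cluster point would contradict sequential compactness.
\<close>
lemma generated_sequence_tendsto:
  assumes g: "g \<in> C \<rightarrow> C" "Q_contraction_on Q C g"
  shows "\<exists>l. variational_solution (Fix C T) g l \<and> (\<forall>z. generated_sequence C T g \<epsilon> z \<longrightarrow> z \<longlonglongrightarrow> l)"
proof -
  have cluster: "\<exists>l r'. strict_mono r' \<and> (z \<circ> r \<circ> r') \<longlonglongrightarrow> l \<and> variational_solution (Fix C T) g l"
    if z: "generated_sequence C T g \<epsilon> z" and r: "strict_mono r" for z and r :: "nat \<Rightarrow> nat"
  proof -
    have "\<forall>n. (z \<circ> r) n \<in> C" using z by (simp add: generated_sequence_def)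
    then obtain l r' where l: "l \<in> C" "strict_mono r'" "((z \<circ> r) \<circ> r') \<longlonglongrightarrow> l"
      using C_seq_compact unfolding seq_compact_def by metis
    then show ?thesis
      using cluster_point_variational_solution[OF g z strict_mono_o[OF r l(2)] l(1)]
      by (auto simp: o_assoc)
  qed
  obtain z where z: "generated_sequence C T g \<epsilon> z" using generated_sequence_ex1[OF g] by blast
  obtain l where l: "variational_solution (Fix C T) g l"
    using cluster[OF z strict_mono_id] by blast
  have "z \<longlonglongrightarrow> l" if z: "generated_sequence C T g \<epsilon> z" for z
  proof (rule ccontr)
    assume "\<not> z \<longlonglongrightarrow> l"
    then obtain q where q: "q \<in> Q" "\<not> (\<lambda>n. q (z n - l)) \<longlonglongrightarrow> 0"
      using tendsto_iff_seminorms[OF top seminorms, of z l sequentially] by blast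
    then obtain e where e: "0 < e" "\<not> (\<forall>\<^sub>F n in sequentially. dist (q (z n - l)) 0 < e)"
      unfolding tendsto_iff by blast
    obtain r :: "nat \<Rightarrow> nat" where r: "strict_mono r" "\<And>n. \<not> dist (q (z (r n) - l)) 0 < e"
      using not_eventually_sequentiallyD[OF e(2)] by blast
    obtain l' r' where r': "(z \<circ> r \<circ> r') \<longlonglongrightarrow> l'" "variational_solution (Fix C T) g l'"
      using cluster[OF z r(1)] by blast
    have "l' = l"
      using variational_solution_unique[OF g(2) _ r'(2) l] by (auto simp: Fix_def)
    then have "(\<lambda>n. q (z (r (r' n)) - l)) \<longlonglongrightarrow> 0"
      using seminorm_tendsto_zero[OF r'(1) q(1)] by (simp add: o_def)
    then have "\<forall>\<^sub>F n in sequentially. dist (q (z (r (r' n)) - l)) 0 < e"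
      using e(1) by (rule tendstoD)
    then show False using r(2) eventually_happens'[OF sequentially_bot] by blast
  qed
  then show ?thesis using l by blast
qed

lemma ex1_point_with_sunny_retraction:
  assumes f: "f \<in> C \<rightarrow> C" "Q_contraction_on Q C f"
  shows "\<exists>!x. x \<in> C \<and>
      (\<exists>P. sunny_Q_nonexpansive_retraction Q C (Fix C T) P \<and>
           f (P x) = x \<and>
           (\<forall>z. generated_sequence C T f \<epsilon> z \<longrightarrow> z \<longlonglongrightarrow> P x))"
proof -
  have FC: "Fix C T \<subseteq> C" by (auto simp: Fix_def)
  have "\<exists>l. variational_solution (Fix C T) (\<lambda>_. u) l" if "u \<in> C" for u
    using generated_sequence_tendsto[of "\<lambda>_. u"] Q_contraction_on_const that by auto
  then obtain P where P: "\<And>u. u \<in> C \<Longrightarrow> variational_solution (Fix C T) (\<lambda>_. u) (P u)"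
    by metis
  obtain l where l: "variational_solution (Fix C T) f l"
    and lim: "\<And>z. generated_sequence C T f \<epsilon> z \<Longrightarrow> z \<longlonglongrightarrow> l"
    using generated_sequence_tendsto[OF f] by blast
  have "l \<in> C" using l FC by (auto simp: variational_solution_def)
  then have fl: "f l \<in> C" using f by auto
  have "variational_solution (Fix C T) (\<lambda>_. f l) l" using l by (simp add: variational_solution_def)
  then have Pfl: "P (f l) = l"
    using variational_solution_unique[OF Q_contraction_on_const FC P[OF fl]] by blast
  obtain z where z: "generated_sequence C T f \<epsilon> z" using generated_sequence_ex1[OF f] by blast
  show ?thesis
  proof (rule ex1I[of _ "f l"])
    show "f l \<in> C \<and> (\<exists>P. sunny_Q_nonexpansive_retraction Q C (Fix C T) P \<and>
           f (P (f l)) = f l \<and> (\<forall>z. generated_sequence C T f \<epsilon> z \<longrightarrow> z \<longlonglongrightarrow> P (f l)))"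
      using fl sunny_retraction_if_variational_solution[OF FC P] Pfl lim by auto
  next
    fix x
    assume "x \<in> C \<and> (\<exists>P. sunny_Q_nonexpansive_retraction Q C (Fix C T) P \<and>
           f (P x) = x \<and> (\<forall>z. generated_sequence C T f \<epsilon> z \<longrightarrow> z \<longlonglongrightarrow> P x))"
    then obtain P' where P': "f (P' x) = x" "z \<longlonglongrightarrow> P' x" using z by blast
    then show "x = f l" using eq_if_tendsto_same[OF _ lim[OF z]] by metis
  qed
qed

end

theorem theorem3p11:
  fixes Q :: "('a::{real_vector, uniform_topological_group_add} \<Rightarrow> real) set"
    and C :: "'a set"
    and T f :: "'a \<Rightarrow> 'a"
    and \<epsilon> :: "nat \<Rightarrow> real"
  assumes "\<forall>q\<in>Q. seminorm q"
    and "determines_topology Q"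
    and "separated Q"
    and "complete (UNIV :: 'a set)"
    and "C \<noteq> {}" and "closed C" and "convex C" and "tvs_bounded C"
    and "\<forall>u. (\<forall>n. u n \<in> C) \<longrightarrow> (\<exists>r::nat \<Rightarrow> nat. strict_mono r \<and> convergent (u \<circ> r))"
    and "T \<in> C \<rightarrow> C" and "Q_nonexpansive_on Q C T" and "Fix C T \<noteq> {}"
    and "\<forall>q\<in>Q. \<forall>x. is_singleton (duality_map q x)"
    and "\<forall>q\<in>Q. {a - b | a b. a \<in> C \<and> b \<in> C} \<inter> {x. q x = 0} = {0}"
    and "f \<in> C \<rightarrow> C" and "Q_contraction_on Q C f"
    and "\<forall>n. 0 < \<epsilon> n \<and> \<epsilon> n < 1" and "\<epsilon> \<longlonglongrightarrow> 0"
  shows "(\<exists>!z. generated_sequence C T f \<epsilon> z) \<and>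
    (\<exists>!x. x \<in> C \<and>
      (\<exists>P. sunny_Q_nonexpansive_retraction Q C (Fix C T) P \<and>
           f (P x) = x \<and>
           (\<forall>z. generated_sequence C T f \<epsilon> z \<longrightarrow> z \<longlonglongrightarrow> P x)))"
proof -
  have "seq_compact C"
    unfolding seq_compact_def
  proof (intro allI impI)
    fix u :: "nat \<Rightarrow> 'a" assume u: "\<forall>n. u n \<in> C"
    then obtain r l where r: "strict_mono r" "(u \<circ> r) \<longlonglongrightarrow> l"
      using assms(9) unfolding convergent_def by blast
    moreover have "l \<in> C"
      using Lim_in_closed_set[OF assms(6) _ _ r(2)] u by simp
    ultimately show "\<exists>l\<in>C. \<exists>r. strict_mono r \<and> (u \<circ> r) \<longlonglongrightarrow> l" by blast
  qed
  then interpret implicit_iteration Q C T \<epsilon>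
    using assms by unfold_locales
  show ?thesis
    using generated_sequence_ex1[OF assms(15,16)] ex1_point_with_sunny_retraction[OF assms(15,16)]
    by blast
qed

end
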